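(* Let $K\subset\mathbb{R}^d$ be a QCO set, $\sigma>0$, $N\ge1$, $\epsilon\in[0,c_0)$, $\alpha\in(0,1/2)$. Let $k_1^\star,k_2^\star$ be the first and second optimal dimensions, $m:=\min\{k_1^\star,k_2^\star\}$, and $$L^2:=\sigma^2\max\left\{\frac{\sqrt{k_1^\star}}{N},\ \epsilon\sqrt{\frac{k_2^\star}{N}},\ \epsilon^2\right\},$$ $$E^2:=\sigma^2\max\left\{\frac{\sqrt m}{N},\ \epsilon^2\ln\Big(\frac1\epsilon\Big),\ \sqrt{\frac{\epsilon^2\ln(1/\epsilon)\,m}{N}}\right\},$$ $$P^2:=\sigma^2\max\left\{\frac{\epsilon\ln(N/\alpha)}{\sqrt N},\ \epsilon^2\ln\Big(\frac N\alpha\Big),\ \sqrt{\frac{\epsilon^2m\ln(N/\alpha)}{N}},\ \frac{\sqrt m\,\ln(1/\alpha)}{N}\right\}.$$ Then the upper bound $E$ matches the lower bound $L$ up to the logarithmic factor $\ln(1/\epsilon)$, i.e. $$L^2\lesssim E^2\lesssim\ln\Big(\frac1\epsilon\Big)L^2,$$ and the upper bound $P$ matches $E$ up to the logarithmic factors $\ln N$, $\ln(1/\alpha)$ and $\ln(1/\epsilon)$, i.e. $E^2\lesssim P^2\lesssim Q\,E^2$ where $Q$ is a fixed polynomial in $\ln N$, $\ln(1/\alpha)$, $\ln(1/\epsilon)$. Here $\lesssim$ hides universal constants.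
   Context: QCO set: $K\subset\mathbb{R}^d$ is quadratically convex orthosymmetric if (1) $K$ is convex; (2) $K^2:=\{(\theta_1^2,\dots,\theta_d^2)^\top:\theta\in K\}$ is convex; (3) $\theta\in K$ implies $(\eta_1\theta_1,\dots,\eta_d\theta_d)^\top\in K$ for all $\eta_i\in\{-1,1\}$. Kolmogorov $k$-width: $D_k(K)=\inf_{P\in\mathcal P_k}\sup_{\theta\in K}\|\theta-P\theta\|_2$, $\mathcal P_k$ being the set of orthogonal projections of rank $k$ in $\mathbb{R}^d$; $D_k(K)=\infty$ for $k<0$, $D_k(K)=0$ for $k>d$. Optimal dimensions: $k_1^\star=\max\{j:0\le j\le d,\ D_{j-1}(K)>\frac{j^{1/4}}{\sqrt N}\sigma\}$ and $k_2^\star=\max\{j:0\le j\le d,\ D_{j-1}(K)>\frac{j^{1/4}\sqrt\epsilon}{N^{1/4}}\sigma\}$. $c_0<1/2$ is a fixed small absolute constant. At $\epsilon=0$, $\epsilon^2\ln(1/\epsilon)$ is read as $0$ and the standalone factor $\ln(1/\epsilon)$ as $+\infty$. Standing assumption of the paper: $D_0(K)=\sup_{\theta\in K}\|\theta\|_2>\sigma/\sqrt N$, i.e. $k_1^\star\ge1$. *)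

theory Defs
  imports
    Complex_Main
    "HOL-Library.Extended_Real"
    "Jordan_Normal_Form.DL_Rank"
begin

text \<open>
  The dimension \<open>d\<close> has to be quantified below the universal constants, so \<open>\<real>\<^sup>d\<close> is the carrier
  \<^term>\<open>carrier_vec d\<close> rather than a type. Vectors of type \<^typ>\<open>real vec\<close> do not form a
  \<^class>\<open>real_vector\<close>, so convexity and the Euclidean norm are spelled out.
\<close>

definition convex_vec :: "real vec set \<Rightarrow> bool" where
  "convex_vec S \<longleftrightarrow>
     (\<forall>x\<in>S. \<forall>y\<in>S. \<forall>u\<ge>0. \<forall>v\<ge>0. u + v = 1 \<longrightarrow> u \<cdot>\<^sub>v x + v \<cdot>\<^sub>v y \<in> S)"

definition norm2 :: "real vec \<Rightarrow> real" where
  "norm2 x = sqrt (scalar_prod x x)"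

definition qco_set :: "nat \<Rightarrow> real vec set \<Rightarrow> bool" where
  "qco_set d K \<longleftrightarrow>
     K \<subseteq> carrier_vec d \<and>
     convex_vec K \<and>
     convex_vec ((\<lambda>\<theta>. vec d (\<lambda>i. (\<theta> $ i)\<^sup>2)) ` K) \<and>
     (\<forall>\<theta>\<in>K. \<forall>\<eta>::nat \<Rightarrow> real. (\<forall>i<d. \<eta> i \<in> {-1, 1}) \<longrightarrow> vec d (\<lambda>i. \<eta> i * \<theta> $ i) \<in> K)"

definition orth_projections :: "nat \<Rightarrow> nat \<Rightarrow> real mat set" where
  "orth_projections d k =
     {P \<in> carrier_mat d d. P\<^sup>T = P \<and> P * P = P \<and> vec_space.rank d P = k}"

text \<open>Values are extended reals since \<open>K\<close> need not be bounded.\<close>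

definition kolmogorov_width :: "nat \<Rightarrow> real vec set \<Rightarrow> int \<Rightarrow> ereal" where
  "kolmogorov_width d K k =
     (if k < 0 then \<infinity>
      else if k > int d then 0
      else INF P\<in>orth_projections d (nat k). SUP \<theta>\<in>K. ereal (norm2 (\<theta> - P *\<^sub>v \<theta>)))"

text \<open>In both maxima \<open>j = 0\<close> is admissible, because the width of index \<open>-1\<close> is infinite.\<close>

definition opt_dim1 :: "nat \<Rightarrow> real vec set \<Rightarrow> real \<Rightarrow> nat \<Rightarrow> nat" where
  "opt_dim1 d K \<sigma> N =
     Max {j. j \<le> d \<and>
             kolmogorov_width d K (int j - 1) > ereal (real j powr (1/4) / sqrt N * \<sigma>)}"

definition opt_dim2 :: "nat \<Rightarrow> real vec set \<Rightarrow> real \<Rightarrow> nat \<Rightarrow> real \<Rightarrow> nat" where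
  "opt_dim2 d K \<sigma> N \<epsilon> =
     Max {j. j \<le> d \<and>
             kolmogorov_width d K (int j - 1)
               > ereal (real j powr (1/4) * sqrt \<epsilon> / real N powr (1/4) * \<sigma>)}"

definition opt_dim_min :: "nat \<Rightarrow> real vec set \<Rightarrow> real \<Rightarrow> nat \<Rightarrow> real \<Rightarrow> nat" where
  "opt_dim_min d K \<sigma> N \<epsilon> = min (opt_dim1 d K \<sigma> N) (opt_dim2 d K \<sigma> N \<epsilon>)"

definition L_sq :: "nat \<Rightarrow> real vec set \<Rightarrow> real \<Rightarrow> nat \<Rightarrow> real \<Rightarrow> real" where
  "L_sq d K \<sigma> N \<epsilon> =
     \<sigma>\<^sup>2 * Max {sqrt (opt_dim1 d K \<sigma> N) / N,
                \<epsilon> * sqrt (opt_dim2 d K \<sigma> N \<epsilon> / N),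
                \<epsilon>\<^sup>2}"

text \<open>
  For \<open>\<epsilon> = 0\<close> the term \<open>\<epsilon>\<^sup>2 * ln (1 / \<epsilon>)\<close> evaluates to its limit \<open>0\<close>, since the factor
  \<open>\<epsilon>\<^sup>2\<close> vanishes.
\<close>

definition E_sq :: "nat \<Rightarrow> real vec set \<Rightarrow> real \<Rightarrow> nat \<Rightarrow> real \<Rightarrow> real" where
  "E_sq d K \<sigma> N \<epsilon> =
     (let m = real (opt_dim_min d K \<sigma> N \<epsilon>) in
      \<sigma>\<^sup>2 * Max {sqrt m / N,
                 \<epsilon>\<^sup>2 * ln (1 / \<epsilon>),
                 sqrt (\<epsilon>\<^sup>2 * ln (1 / \<epsilon>) * m / N)})"

definition P_sq :: "nat \<Rightarrow> real vec set \<Rightarrow> real \<Rightarrow> nat \<Rightarrow> real \<Rightarrow> real \<Rightarrow> real" where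
  "P_sq d K \<sigma> N \<epsilon> \<alpha> =
     (let m = real (opt_dim_min d K \<sigma> N \<epsilon>) in
      \<sigma>\<^sup>2 * Max {\<epsilon> * ln (N / \<alpha>) / sqrt N,
                 \<epsilon>\<^sup>2 * ln (N / \<alpha>),
                 sqrt (\<epsilon>\<^sup>2 * m * ln (N / \<alpha>) / N),
                 sqrt m * ln (1 / \<alpha>) / N})"

text \<open>The standalone factor \<open>ln (1 / \<epsilon>)\<close>, infinite for \<open>\<epsilon> = 0\<close>.\<close>

definition ln_inv :: "real \<Rightarrow> ereal" where
  "ln_inv \<epsilon> = (if \<epsilon> = 0 then \<infinity> else ereal (ln (1 / \<epsilon>)))"

text \<open>
  Polynomial of degree at most \<open>n\<close> in each of three variables, with coefficients \<open>c\<close>. An argument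
  may be infinite, so it is only used with nonnegative coefficients and arguments. The \<^typ>\<open>ereal\<close>
  conventions \<open>0 * \<infinity> = 0\<close> and \<open>\<infinity> ^ 0 = 1\<close> ensure that an infinite argument contributes only
  through monomials that contain it with a nonzero coefficient.
\<close>

definition eval_poly3 ::
    "nat \<Rightarrow> (nat \<Rightarrow> nat \<Rightarrow> nat \<Rightarrow> real) \<Rightarrow> ereal \<Rightarrow> ereal \<Rightarrow> ereal \<Rightarrow> ereal" where
  "eval_poly3 n c x y z = (\<Sum>i\<le>n. \<Sum>j\<le>n. \<Sum>k\<le>n. ereal (c i j k) * x ^ i * y ^ j * z ^ k)"

end

theory Submission
  imports Defs
begin

text \<open>
  Extending a projection by one dimension shows that the Kolmogorov widths decrease in their index.
  Since both optimal dimensions compare the same widths with the thresholds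
  \<open>j\<^sup>1\<^sup>/\<^sup>4 \<sigma> / \<surd>N\<close> and \<open>j\<^sup>1\<^sup>/\<^sup>4 \<surd>\<epsilon> \<sigma> / N\<^sup>1\<^sup>/\<^sup>4\<close>, a strict inequality between
  them can be traded for an inequality between the thresholds at \<open>k\<close> and \<open>k' + 1\<close>, where \<open>k' < k\<close>.
  So \<open>k\<^sub>2 < k\<^sub>1\<close> gives \<open>\<surd>k\<^sub>1 / N \<le> \<surd>(k\<^sub>2 + 1) \<epsilon> / \<surd>N\<close> and in particular
  \<open>\<epsilon> \<ge> 1 / \<surd>N\<close>, and symmetrically for \<open>k\<^sub>1 < k\<^sub>2\<close>. With these and
  \<open>\<epsilon>\<^sup>2 ln (1 / \<epsilon>) \<le> \<epsilon>\<^sup>2 ln N / 2 + min {\<epsilon> / \<surd>N, 1 / N}\<close>, the rates are compared term by term,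
  and \<open>Q = ln N + ln (1 / \<alpha>)\<close> suffices.
\<close>

section \<open>Rank and column spaces\<close>

text \<open>The rank is the dimension of the column span taken as a vector space of its own, so the
  independence of \<open>U\<close> is first transferred to that space.\<close>

lemma (in vec_space) card_le_rank_if_lin_indpt_in_col_space:
  assumes A: "A \<in> carrier_mat n nc"
    and U: "U \<subseteq> span (set (cols A))" "lin_indpt U"
  shows "card U \<le> rank A"
proof -
  have c: "set (cols A) \<subseteq> carrier_vec n"
    using A cols_dim[of A] by auto
  have sub: "submodule class_ring (span (set (cols A))) V"
    using c by (intro span_is_submodule) simp
  interpret W: vectorspace class_ring "span_vs (set (cols A))"
    using c by (intro subspace_is_vs span_is_subspace) simp
  have "\<not> module.lin_dep class_ring (span_vs (set (cols A))) U"
    using span_li_not_depend(2)[OF U(1) sub] U(2) by simp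
  then show ?thesis
    unfolding rank_def
    using W.li_le_dim(2)[of U] fin_dim_span_cols[OF A] U(1) by simp
qed

text \<open>A maximal independent set \<open>S\<close> of columns of \<open>P\<close> has
  \<open>rank P\<close> elements, and \<open>v\<close> lies outside its span; adding
  \<open>v\<close> gives an independent set with one more element inside the column space of
  \<open>Q\<close>.\<close>

lemma (in vec_space) rank_less_if_col_space_psubset:
  assumes P: "P \<in> carrier_mat n nc" and Q: "Q \<in> carrier_mat n nc'"
    and sub: "span (set (cols P)) \<subseteq> span (set (cols Q))"
    and v: "v \<in> span (set (cols Q))" "v \<notin> span (set (cols P))"
  shows "rank P < rank Q"
proof -
  have cP: "set (cols P) \<subseteq> carrier_vec n" and cQ: "set (cols Q) \<subseteq> carrier_vec n"
    using P Q cols_dim[of P] cols_dim[of Q] by auto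
  have "lin_indpt {}"
    by (auto simp: lin_dep_def)
  then obtain S where S: "maximal S (\<lambda>T. T \<subseteq> set (cols P) \<and> lin_indpt T)" "finite S"
    using maximal_exists_superset[of "set (cols P)" "\<lambda>T. T \<subseteq> set (cols P) \<and> lin_indpt T" "{}"]
    by auto
  then have SP: "S \<subseteq> set (cols P)" and li: "lin_indpt S"
    by (auto simp: maximal_def)
  have vS: "v \<notin> span S"
    using v(2) span_is_monotone[OF SP] by auto
  have vc: "v \<in> carrier_vec n"
    using v(1) cQ span_closed by auto
  have li': "lin_indpt (S \<union> {v})"
    using lin_dep_iff_in_span[of S v] SP cP li vc vS span_mem[of S v] by auto
  have "S \<union> {v} \<subseteq> span (set (cols Q))"
    using SP in_own_span[of "set (cols P)"] cP sub v(1) by auto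
  from card_le_rank_if_lin_indpt_in_col_space[OF Q this li']
  have "card (S \<union> {v}) \<le> rank Q" .
  moreover have "v \<notin> S"
    using vS SP cP span_mem[of S v] by auto
  ultimately show ?thesis
    using rank_card_indpt[OF P S(1)] S(2) by simp
qed

section \<open>Extending an orthogonal projection by one dimension\<close>

lemma mat_eq_if_mult_mat_vec_eq:
  fixes A B :: "'a :: comm_semiring_1 mat"
  assumes "A \<in> carrier_mat m n" "B \<in> carrier_mat m n"
    and eq: "\<And>x. x \<in> carrier_vec n \<Longrightarrow> A *\<^sub>v x = B *\<^sub>v x"
  shows "A = B"
proof (rule eq_matI)
  fix i j assume ij: "i < dim_row B" "j < dim_col B"
  have "(A *\<^sub>v unit_vec n j) $ i = (B *\<^sub>v unit_vec n j) $ i"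
    by (simp add: eq)
  then show "A $$ (i, j) = B $$ (i, j)"
    using assms(1,2) ij by (auto simp: scalar_prod_right_unit)
qed (use assms in auto)

lemma scalar_prod_self_nonneg: "(v :: real vec) \<bullet> v \<ge> 0"
  by (auto simp: scalar_prod_def intro: sum_nonneg)

lemma scalar_prod_self_eq_0_iff:
  fixes v :: "real vec"
  assumes "v \<in> carrier_vec n"
  shows "v \<bullet> v = 0 \<longleftrightarrow> v = 0\<^sub>v n"
  using assms by (auto simp: scalar_prod_def sum_nonneg_eq_0_iff intro!: eq_vecI)

lemma mult_mat_vec_outer:
  fixes v x :: "real vec"
  assumes "v \<in> carrier_vec d" "x \<in> carrier_vec d"
  shows "mat d d (\<lambda>(i, j). v $ i * v $ j) *\<^sub>v x = (v \<bullet> x) \<cdot>\<^sub>v v"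
  using assms
  by (intro eq_vecI) (auto simp: scalar_prod_def sum_distrib_left sum_distrib_right ac_simps)

text \<open>As \<open>k < d\<close>, \<open>P\<close> is not the identity, so some unit vector
  \<open>v\<close> lies in its kernel. Adding the projection onto the line of \<open>v\<close>
  removes from each residual its component along \<open>v\<close>, which cannot lengthen it.\<close>

lemma orth_projection_extend:
  assumes P: "P \<in> orth_projections d k" and "k < d"
  obtains Q where "Q \<in> orth_projections d (Suc k)"
    "\<And>x. x \<in> carrier_vec d \<Longrightarrow> norm2 (x - Q *\<^sub>v x) \<le> norm2 (x - P *\<^sub>v x)"
proof -
  interpret vec_space "TYPE(real)" d .
  have Pc: "P \<in> carrier_mat d d" and Pt: "P\<^sup>T = P" and PP: "P * P = P" and rk: "rank P = k"
    using P by (auto simp: orth_projections_def)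
  have Pvc[simp]: "P *\<^sub>v x \<in> carrier_vec d" if "x \<in> carrier_vec d" for x
    using Pc that by simp
  have PPv: "P *\<^sub>v (P *\<^sub>v x) = P *\<^sub>v x" if "x \<in> carrier_vec d" for x
    using assoc_mult_mat_vec[OF Pc Pc that] PP by simp
  have sym: "(P *\<^sub>v x) \<bullet> y = x \<bullet> (P *\<^sub>v y)" if "x \<in> carrier_vec d" "y \<in> carrier_vec d" for x y
    using transpose_vec_mult_scalar[OF Pc that(2) that(1)] Pt by simp
  have "\<exists>x\<in>carrier_vec d. P *\<^sub>v x \<noteq> x"
  proof (rule ccontr)
    assume "\<not> ?thesis"
    then have "P = 1\<^sub>m d"
      using Pc by (intro mat_eq_if_mult_mat_vec_eq[of _ d d]) auto
    then have "rank P = d"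
      using low_rank_det_zero[of "1\<^sub>m d"] by simp
    with rk \<open>k < d\<close> show False by simp
  qed
  then obtain x where x: "x \<in> carrier_vec d" "P *\<^sub>v x \<noteq> x" by blast
  define w where "w = x - P *\<^sub>v x"
  have wc: "w \<in> carrier_vec d" using x(1) Pc by (auto simp: w_def)
  have Pw: "P *\<^sub>v w = 0\<^sub>v d"
    using x(1) PPv[OF x(1)] mult_minus_distrib_mat_vec[OF Pc x(1) Pvc[OF x(1)]]
    by (simp add: w_def)
  have "w \<noteq> 0\<^sub>v d"
  proof
    assume w0: "w = 0\<^sub>v d"
    have "P *\<^sub>v x = x"
    proof (rule eq_vecI)
      fix i assume i: "i < dim_vec x"
      have "w $ i = 0" using w0 i x(1) by simp
      then show "(P *\<^sub>v x) $ i = x $ i" using i x(1) Pc by (simp add: w_def)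
    qed (use x Pc in auto)
    with x(2) show False ..
  qed
  then have ww: "w \<bullet> w > 0"
    using scalar_prod_self_nonneg[of w] scalar_prod_self_eq_0_iff[OF wc] by linarith
  define v where "v = (1 / sqrt (w \<bullet> w)) \<cdot>\<^sub>v w"
  have vc[simp]: "v \<in> carrier_vec d" using wc by (simp add: v_def)
  have vv: "v \<bullet> v = 1" using wc ww by (simp add: v_def)
  have Pv: "P *\<^sub>v v = 0\<^sub>v d"
    using mult_mat_vec[OF Pc wc] Pw by (simp add: v_def)
  define M where "M = mat d d (\<lambda>(i, j). v $ i * v $ j)"
  have Mc: "M \<in> carrier_mat d d" by (simp add: M_def)
  define Q where "Q = P + M"
  have Qc: "Q \<in> carrier_mat d d" using Pc Mc by (simp add: Q_def)
  have Qv: "Q *\<^sub>v y = P *\<^sub>v y + (v \<bullet> y) \<cdot>\<^sub>v v" if "y \<in> carrier_vec d" for y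
    using add_mult_distrib_mat_vec[OF Pc Mc that] mult_mat_vec_outer[OF vc that]
    by (simp add: Q_def M_def)
  \<comment> \<open>By symmetry of \<open>P\<close>, its range is orthogonal to its kernel; this
    kills the cross terms in \<open>Q * Q\<close>.\<close>
  have vP: "v \<bullet> (P *\<^sub>v y) = 0" if "y \<in> carrier_vec d" for y
    using sym[OF vc that] Pv that by simp
  have PQ: "P *\<^sub>v (Q *\<^sub>v y) = P *\<^sub>v y" and vQ: "v \<bullet> (Q *\<^sub>v y) = v \<bullet> y"
    if y: "y \<in> carrier_vec d" for y
    using y mult_add_distrib_mat_vec[OF Pc Pvc[OF y], of "(v \<bullet> y) \<cdot>\<^sub>v v"] mult_mat_vec[OF Pc vc]
      scalar_prod_add_distrib[OF vc Pvc[OF y], of "(v \<bullet> y) \<cdot>\<^sub>v v"]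
    by (simp_all add: Qv Pv PPv vP vv)
  have "Q * Q = Q"
  proof (rule mat_eq_if_mult_mat_vec_eq)
    fix y :: "real vec" assume y: "y \<in> carrier_vec d"
    have "Q *\<^sub>v (Q *\<^sub>v y) = Q *\<^sub>v y"
      using Qv[of "Q *\<^sub>v y"] Qv[OF y] PQ[OF y] vQ[OF y] y Qc by simp
    then show "(Q * Q) *\<^sub>v y = Q *\<^sub>v y"
      using assoc_mult_mat_vec[OF Qc Qc y] by simp
  qed (use Qc in auto)
  moreover have "Q\<^sup>T = Q"
  proof -
    have "M\<^sup>T = M" by (auto simp: M_def)
    then show ?thesis using transpose_add[OF Pc Mc] Pt by (simp add: Q_def)
  qed
  \<comment> \<open>The upper bound is subadditivity with a summand of rank at most 1; the lower
    bound holds because \<open>v\<close> is in the range of \<open>Q\<close> but not in that of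
    \<open>P\<close>.\<close>
  moreover have "rank Q = Suc k"
  proof -
    have "rank M \<le> 1"
      by (rule rank_le_1_product_entries[OF Mc, of "\<lambda>i. v $ i" "\<lambda>i. v $ i"]) (simp add: M_def)
    then have "rank Q \<le> Suc k"
      using rank_subadditive[OF Pc Mc] rk by (simp add: Q_def)
    moreover have "rank P < rank Q"
    proof (rule rank_less_if_col_space_psubset[OF Pc Qc])
      have colP: "span (set (cols P)) = {y\<in>carrier_vec d. \<exists>x\<in>carrier_vec d. P *\<^sub>v x = y}"
        using col_space_eq[OF Pc] Pc by (simp add: col_space_def)
      have colQ: "span (set (cols Q)) = {y\<in>carrier_vec d. \<exists>x\<in>carrier_vec d. Q *\<^sub>v x = y}"
        using col_space_eq[OF Qc] Qc by (simp add: col_space_def)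
      have "Q *\<^sub>v (P *\<^sub>v y) = P *\<^sub>v y" if "y \<in> carrier_vec d" for y
        using Qv[OF Pvc[OF that]] PPv[OF that] vP[OF that] that Pvc[OF that] by simp
      then show "span (set (cols P)) \<subseteq> span (set (cols Q))"
        unfolding colP colQ using Pvc by blast
      have "Q *\<^sub>v v = v" using Qv[OF vc] Pv vv by simp
      then show "v \<in> span (set (cols Q))" unfolding colQ using vc by blast
      show "v \<notin> span (set (cols P))"
      proof
        assume "v \<in> span (set (cols P))"
        then obtain y where "y \<in> carrier_vec d" "P *\<^sub>v y = v" unfolding colP by blast
        then have "v = 0\<^sub>v d" using PPv[of y] Pv by simp
        with vv show False by simp
      qed
    qed
    ultimately show ?thesis using rk by simp
  qed
  ultimately have "Q \<in> orth_projections d (Suc k)"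
    using Qc by (simp add: orth_projections_def)
  moreover have "norm2 (y - Q *\<^sub>v y) \<le> norm2 (y - P *\<^sub>v y)" if y: "y \<in> carrier_vec d" for y
  proof -
    define r where "r = y - P *\<^sub>v y"
    define t where "t = v \<bullet> y"
    have rc: "r \<in> carrier_vec d" using y Pc by (auto simp: r_def)
    have vr: "v \<bullet> r = t" using y vP[OF y] scalar_prod_minus_distrib[OF vc y Pvc[OF y]]
      by (simp add: r_def t_def)
    then have rv: "r \<bullet> v = t" using comm_scalar_prod[OF rc vc] by simp
    have tc: "t \<cdot>\<^sub>v v \<in> carrier_vec d" by simp
    have "y - Q *\<^sub>v y = r - t \<cdot>\<^sub>v v"
      using y Pc vc Qv[OF y] by (intro eq_vecI) (auto simp: r_def t_def simp del: vc)
    \<comment> \<open>Pythagoras: \<open>t\<close> is the component of \<open>r\<close> along the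
      unit vector \<open>v\<close>.\<close>
    moreover have "(r - t \<cdot>\<^sub>v v) \<bullet> (r - t \<cdot>\<^sub>v v) = r \<bullet> r - t\<^sup>2"
      using rc tc vr rv vv
      by (simp add: minus_scalar_prod_distrib[of _ d] scalar_prod_minus_distrib[of _ d]
          power2_eq_square)
    ultimately show ?thesis by (simp add: norm2_def r_def)
  qed
  ultimately show thesis by (rule that)
qed

section \<open>Monotonicity of the Kolmogorov widths\<close>

lemma kolmogorov_width_Suc_le:
  assumes K: "K \<subseteq> carrier_vec d" and "k < d"
  shows "kolmogorov_width d K (int (Suc k)) \<le> kolmogorov_width d K (int k)"
proof -
  have "(INF Q\<in>orth_projections d (Suc k). SUP \<theta>\<in>K. ereal (norm2 (\<theta> - Q *\<^sub>v \<theta>)))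
      \<le> (INF P\<in>orth_projections d k. SUP \<theta>\<in>K. ereal (norm2 (\<theta> - P *\<^sub>v \<theta>)))"
  proof (rule INF_mono)
    fix P assume "P \<in> orth_projections d k"
    then obtain Q where "Q \<in> orth_projections d (Suc k)"
      "\<And>x. x \<in> carrier_vec d \<Longrightarrow> norm2 (x - Q *\<^sub>v x) \<le> norm2 (x - P *\<^sub>v x)"
      using orth_projection_extend \<open>k < d\<close> by blast
    then show "\<exists>Q\<in>orth_projections d (Suc k).
        (SUP \<theta>\<in>K. ereal (norm2 (\<theta> - Q *\<^sub>v \<theta>))) \<le> (SUP \<theta>\<in>K. ereal (norm2 (\<theta> - P *\<^sub>v \<theta>)))"
      using K by (intro bexI[of _ Q] SUP_mono) auto
  qed
  then show ?thesis using \<open>k < d\<close> by (simp add: kolmogorov_width_def nat_add_distrib flip: of_nat_Suc)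
qed

lemma kolmogorov_width_antimono:
  assumes "K \<subseteq> carrier_vec d" and "k \<le> l" "l \<le> d"
  shows "kolmogorov_width d K (int l) \<le> kolmogorov_width d K (int k)"
  using \<open>k \<le> l\<close> \<open>l \<le> d\<close>
proof (induction l rule: dec_induct)
  case (step l)
  then show ?case
    using kolmogorov_width_Suc_le[OF assms(1), of l] by (meson Suc_leD Suc_le_eq order.trans)
qed simp

text \<open>Serves to exclude \<open>d = 0\<close> under the standing assumption. It is an
  inequality because the supremum over an empty \<open>K\<close> is minus infinity.\<close>

lemma kolmogorov_width_dim_0_le:
  assumes "K \<subseteq> carrier_vec 0"
  shows "kolmogorov_width 0 K 0 \<le> 0"
proof -
  have "0\<^sub>m 0 0 \<in> orth_projections 0 0"
    by (simp add: orth_projections_def vec_space.rank_0I)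
  then have "kolmogorov_width 0 K 0 \<le> (SUP \<theta>\<in>K. ereal (norm2 (\<theta> - 0\<^sub>m 0 0 *\<^sub>v \<theta>)))"
    by (auto simp: kolmogorov_width_def intro: INF_lower2)
  also have "\<dots> \<le> 0"
    using assms by (intro SUP_least) (auto simp: norm2_def scalar_prod_def)
  finally show ?thesis .
qed

section \<open>Optimal dimensions and their thresholds\<close>

text \<open>Both optimal dimensions are instances of this maximum, for two threshold functions.\<close>

lemma Max_width_dims:
  fixes f :: "nat \<Rightarrow> real" and d :: nat and K :: "real vec set"
  defines "S \<equiv> {j. j \<le> d \<and> kolmogorov_width d K (int j - 1) > ereal (f j)}"
  shows "Max S \<in> S" and "\<And>j. j \<in> S \<Longrightarrow> j \<le> Max S"
proof -
  have "finite S" by (simp add: S_def)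
  moreover have "0 \<in> S" by (simp add: S_def kolmogorov_width_def)
  ultimately show "Max S \<in> S" "\<And>j. j \<in> S \<Longrightarrow> j \<le> Max S" by (auto intro: Max_in)
qed

text \<open>The threshold \<open>f a\<close> is below the width of index \<open>a - 1\<close>, as
  \<open>a\<close> is admissible. That width is at most the one of index \<open>b\<close>, as
  \<open>b \<le> a - 1\<close>, which in turn is at most \<open>g (Suc b)\<close>, as
  \<open>Suc b\<close> exceeds the maximum \<open>b\<close>.\<close>

lemma threshold_less_if_Max_width_dims_less:
  fixes f g :: "nat \<Rightarrow> real" and d :: nat and K :: "real vec set"
  assumes K: "K \<subseteq> carrier_vec d"
  defines "a \<equiv> Max {j. j \<le> d \<and> kolmogorov_width d K (int j - 1) > ereal (f j)}"
    and "b \<equiv> Max {j. j \<le> d \<and> kolmogorov_width d K (int j - 1) > ereal (g j)}"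
  assumes "b < a"
  shows "f a < g (Suc b)"
proof -
  have a: "a \<le> d" "ereal (f a) < kolmogorov_width d K (int a - 1)"
    using Max_width_dims(1)[where d=d and K=K and f=f] by (auto simp: a_def)
  \<comment> \<open>Hence \<open>Suc b\<close> is inadmissible because of its width, not because of
    the bound \<open>d\<close>.\<close>
  have "Suc b \<le> d" using \<open>b < a\<close> a(1) by simp
  then have "\<not> kolmogorov_width d K (int b) > ereal (g (Suc b))"
    using Max_width_dims(2)[where d=d and K=K and f=g and j="Suc b"] by (auto simp flip: b_def)
  moreover have "kolmogorov_width d K (int a - 1) \<le> kolmogorov_width d K (int b)"
    using kolmogorov_width_antimono[OF K, of b "a - 1"] \<open>b < a\<close> a(1) by (simp add: of_nat_diff)
  ultimately have "ereal (f a) < ereal (g (Suc b))"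
    using a(2) by (meson not_less order.strict_trans2)
  then show ?thesis by simp
qed


text \<open>The assumption on the width is the admissibility of \<open>j = 1\<close>, once
  \<open>d \<ge> 1\<close> is known.\<close>

lemma opt_dim1_pos:
  assumes K: "K \<subseteq> carrier_vec d" and "\<sigma> > 0"
    and D: "kolmogorov_width d K 0 > ereal (\<sigma> / sqrt N)"
  shows "opt_dim1 d K \<sigma> N \<ge> 1"
proof -
  have "d \<noteq> 0"
  proof
    assume "d = 0"
    then have "kolmogorov_width d K 0 \<le> 0"
      using kolmogorov_width_dim_0_le K by simp
    also have "0 \<le> ereal (\<sigma> / sqrt N)"
      using \<open>\<sigma> > 0\<close> by simp
    finally show False using D by simp
  qed
  then show ?thesis
    unfolding opt_dim1_def using D by (intro Max_width_dims(2)) simp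
qed

text \<open>Squaring turns the fourth roots of the thresholds into the square roots that occur in
  the rates.\<close>

lemma sqrt_threshold_mult_square:
  assumes "\<epsilon> \<ge> 0" "\<sigma> > 0"
  shows "(real j powr (1/4) / sqrt (real N) * \<sigma>)\<^sup>2 = sqrt j / N * \<sigma>\<^sup>2"
    and "(real j powr (1/4) * sqrt \<epsilon> / real N powr (1/4) * \<sigma>)\<^sup>2 = sqrt j * \<epsilon> / sqrt N * \<sigma>\<^sup>2"
proof -
  have "(t powr (1/4))\<^sup>2 = sqrt t" if "t \<ge> 0" for t :: real
    using that by (simp add: power2_eq_square powr_half_sqrt flip: powr_add)
  then show "(real j powr (1/4) / sqrt (real N) * \<sigma>)\<^sup>2 = sqrt j / N * \<sigma>\<^sup>2"
    "(real j powr (1/4) * sqrt \<epsilon> / real N powr (1/4) * \<sigma>)\<^sup>2 = sqrt j * \<epsilon> / sqrt N * \<sigma>\<^sup>2"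
    using assms by (simp_all add: power_mult_distrib power_divide)
qed

lemma le_if_mult_square_less:
  fixes s t u v \<sigma> :: real
  assumes "0 \<le> u" "\<sigma> > 0" "u < v" "u\<^sup>2 = s * \<sigma>\<^sup>2" "v\<^sup>2 = t * \<sigma>\<^sup>2"
  shows "s \<le> t"
proof -
  have "s * \<sigma>\<^sup>2 \<le> t * \<sigma>\<^sup>2"
    using power_mono[of u v 2] assms by simp
  then show ?thesis using \<open>\<sigma> > 0\<close> by simp
qed

lemma opt_dim2_less_opt_dim1D:
  assumes K: "K \<subseteq> carrier_vec d" and "\<sigma> > 0" and "\<epsilon> \<ge> 0"
    and "opt_dim2 d K \<sigma> N \<epsilon> < opt_dim1 d K \<sigma> N"
  shows "sqrt (opt_dim1 d K \<sigma> N) / N \<le> sqrt (Suc (opt_dim2 d K \<sigma> N \<epsilon>)) * \<epsilon> / sqrt N"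
  using threshold_less_if_Max_width_dims_less[OF K assms(4)[unfolded opt_dim1_def opt_dim2_def]] assms(2,3)
  by (intro le_if_mult_square_less[OF _ _ _ sqrt_threshold_mult_square[of \<epsilon> \<sigma>]])
     (auto simp: opt_dim1_def opt_dim2_def)

lemma opt_dim1_less_opt_dim2D:
  assumes K: "K \<subseteq> carrier_vec d" and "\<sigma> > 0" and "\<epsilon> \<ge> 0"
    and "opt_dim1 d K \<sigma> N < opt_dim2 d K \<sigma> N \<epsilon>"
  shows "sqrt (opt_dim2 d K \<sigma> N \<epsilon>) * \<epsilon> / sqrt N \<le> sqrt (Suc (opt_dim1 d K \<sigma> N)) / N"
  using threshold_less_if_Max_width_dims_less[OF K assms(4)[unfolded opt_dim1_def opt_dim2_def]] assms(2,3)
  by (intro le_if_mult_square_less[OF _ _ _ sqrt_threshold_mult_square(2,1)[of \<epsilon> \<sigma>]])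
     (auto simp: opt_dim1_def opt_dim2_def)

section \<open>Elementary bounds on logarithms\<close>

text \<open>From \<open>ln t \<le> t - 1 < -1/2\<close>. It keeps the logarithmic factors away from
  0, so that dropping one costs only a factor 2.\<close>

lemma half_le_ln_inverse:
  fixes t :: real
  assumes "0 < t" "t < 1/2"
  shows "1/2 \<le> ln (1 / t)"
  using ln_le_minus_one[of t] assms by (simp add: ln_div)

text \<open>With \<open>t = \<epsilon> * sqrt n\<close>, \<open>ln (1 / \<epsilon>)\<close> splits
  into \<open>ln n / 2 + ln (1 / t)\<close>. Since \<open>t * ln (1 / t) \<le> 1 - t\<close>, the
  second summand contributes at most \<open>t * (1 - t) / n\<close>, which is below both
  \<open>t / n = \<epsilon> / sqrt n\<close> and \<open>1 / n\<close>.\<close>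

lemma square_mult_ln_inverse_le:
  fixes \<epsilon> n :: real
  assumes "\<epsilon> \<ge> 0" "n \<ge> 1"
  shows "\<epsilon>\<^sup>2 * ln (1 / \<epsilon>) \<le> \<epsilon>\<^sup>2 * ln n / 2 + \<epsilon> / sqrt n"
    and "\<epsilon>\<^sup>2 * ln (1 / \<epsilon>) \<le> \<epsilon>\<^sup>2 * ln n / 2 + 1 / n"
proof -
  have *: "\<epsilon>\<^sup>2 * ln (1 / \<epsilon>) \<le> \<epsilon>\<^sup>2 * ln n / 2 + \<epsilon> / sqrt n
    \<and> \<epsilon>\<^sup>2 * ln (1 / \<epsilon>) \<le> \<epsilon>\<^sup>2 * ln n / 2 + 1 / n"
  proof (cases "\<epsilon> = 0")
    case False
    then have "\<epsilon> > 0" using assms by simp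
    define t where "t = \<epsilon> * sqrt n"
    have t: "t > 0" and \<epsilon>: "\<epsilon> = t / sqrt n"
      using \<open>\<epsilon> > 0\<close> assms by (auto simp: t_def)
    have "ln (1 / t) \<le> 1 / t - 1"
      using t by (intro ln_le_minus_one) simp
    then have u: "t * ln (1 / t) \<le> 1 - t"
      using t by (simp add: field_simps)
    have "ln (1 / \<epsilon>) = ln n / 2 + ln (1 / t)"
      using t assms by (simp add: \<epsilon> ln_div ln_sqrt)
    then have eq: "\<epsilon>\<^sup>2 * ln (1 / \<epsilon>) = \<epsilon>\<^sup>2 * ln n / 2 + \<epsilon> / sqrt n * (t * ln (1 / t))"
      using t assms by (simp add: \<epsilon> algebra_simps power2_eq_square)
    have "\<epsilon> / sqrt n * (t * ln (1 / t)) \<le> \<epsilon> / sqrt n * (1 - t)"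
      using u \<open>\<epsilon> > 0\<close> assms by (intro mult_left_mono) auto
    also have "\<dots> = t * (1 - t) / n"
      using assms by (simp add: \<epsilon>)
    finally have le: "\<epsilon> / sqrt n * (t * ln (1 / t)) \<le> t * (1 - t) / n" .
    have "t * (1 - t) \<le> 1"
      using zero_le_power2[of "t - 1/2"] by (simp add: power2_eq_square algebra_simps)
    then have "t * (1 - t) / n \<le> 1 / n"
      using assms by (intro divide_right_mono) auto
    moreover have "t * (1 - t) / n \<le> \<epsilon> / sqrt n"
      using t assms by (simp add: \<epsilon> divide_simps)
    ultimately show ?thesis using eq le by linarith
  qed (use assms in simp)
  show "\<epsilon>\<^sup>2 * ln (1 / \<epsilon>) \<le> \<epsilon>\<^sup>2 * ln n / 2 + \<epsilon> / sqrt n"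
    "\<epsilon>\<^sup>2 * ln (1 / \<epsilon>) \<le> \<epsilon>\<^sup>2 * ln n / 2 + 1 / n" using * by blast+
qed

lemma sqrt_le_two_mult:
  fixes y :: real
  assumes "1/2 \<le> y"
  shows "sqrt y \<le> 2 * y"
  using assms by (intro real_le_lsqrt) (auto simp: power2_eq_square)

text \<open>\<open>z\<close> may be infinite: all monomials containing it have coefficient 0, and
  \<open>0 * \<infinity> = 0\<close>.\<close>

lemma eval_poly3_sum_of_first_two:
  "eval_poly3 1 (\<lambda>i j k. if i + j = 1 \<and> k = 0 then 1 else 0) (ereal x) (ereal y) z = ereal (x + y)"
  by (simp add: eval_poly3_def flip: zero_ereal_def)

section \<open>Term-by-term comparison of the rates\<close>

text \<open>
  Here \<open>a\<close>, \<open>b\<close> and \<open>y\<close> stand for \<open>k\<^sub>1\<close>, \<open>k\<^sub>2\<close> and \<open>ln (1 / \<alpha>)\<close>, and the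
  rates carry no factor \<open>\<sigma>\<^sup>2\<close>.
\<close>

locale rate_comparison =
  fixes a b n \<epsilon> y :: real
  assumes a: "1 \<le> a" and b: "0 \<le> b" and n: "1 \<le> n" and \<epsilon>: "0 \<le> \<epsilon>" "\<epsilon> < 1/2"
    and y: "1/2 \<le> y"
    and ba: "b < a \<Longrightarrow> b + 1 \<le> a \<and> sqrt a / n \<le> sqrt (b + 1) * \<epsilon> / sqrt n"
    and ab: "a < b \<Longrightarrow> a + 1 \<le> b \<and> sqrt b * \<epsilon> / sqrt n \<le> sqrt (a + 1) / n"
begin

definition "r = 1 / sqrt n"
definition "l = ln (1 / \<epsilon>)"
definition "m = min a b"
definition "L = Max {sqrt a / n, \<epsilon> * sqrt (b / n), \<epsilon>\<^sup>2}"
definition "E = Max {sqrt m / n, \<epsilon>\<^sup>2 * l, sqrt (\<epsilon>\<^sup>2 * l * m / n)}"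
text \<open>This is \<open>ln (N / \<alpha>)\<close>, and also the value of the polynomial
  \<open>Q\<close>.\<close>

definition "Y = ln n + y"
definition "P = Max {\<epsilon> * Y / sqrt n, \<epsilon>\<^sup>2 * Y, sqrt (\<epsilon>\<^sup>2 * m * Y / n), sqrt m * y / n}"

lemma r: "0 < r" "1 / n = r\<^sup>2"
  using n by (auto simp: r_def power_divide)

lemma Y: "1/2 \<le> Y" "y \<le> Y" "ln n \<le> Y"
  using y ln_ge_zero[OF n] by (simp_all add: Y_def)

lemma m_nonneg: "0 \<le> m"
  using a b by (simp add: m_def)

lemma l_pos: "0 < \<epsilon> \<Longrightarrow> 1/2 \<le> l"
  using \<epsilon> by (simp only: l_def half_le_ln_inverse)


text \<open>The six lemmas up to \<open>P_le\<close> resolve the maxima into their terms, with roots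
  split and divisions written as powers of \<open>r\<close>; the comparisons rely on these
  forms.\<close>

lemma L_ge: "sqrt a * r\<^sup>2 \<le> L" "\<epsilon> * sqrt b * r \<le> L" "\<epsilon>\<^sup>2 \<le> L"
  by (auto simp: L_def real_sqrt_divide r_def power_divide n order_trans[OF _ n])

lemma E_ge: "sqrt m * r\<^sup>2 \<le> E" "\<epsilon>\<^sup>2 * l \<le> E" "\<epsilon> * sqrt l * sqrt m * r \<le> E"
  using n \<epsilon> by (auto simp: E_def real_sqrt_divide real_sqrt_mult r_def power_divide)

lemma P_ge: "\<epsilon> * r * Y \<le> P" "\<epsilon>\<^sup>2 * Y \<le> P" "\<epsilon> * sqrt m * r * sqrt Y \<le> P" "sqrt m * r\<^sup>2 * y \<le> P"
  using n \<epsilon> by (auto simp: P_def real_sqrt_divide real_sqrt_mult r_def power_divide max_def mult_ac)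

lemma L_le:
  assumes "sqrt a * r\<^sup>2 \<le> c" "\<epsilon> * sqrt b * r \<le> c" "\<epsilon>\<^sup>2 \<le> c"
  shows "L \<le> c"
  using assms n by (simp add: L_def real_sqrt_divide r_def power_divide)

lemma E_le:
  assumes "sqrt m * r\<^sup>2 \<le> c" "\<epsilon>\<^sup>2 * l \<le> c" "\<epsilon> * sqrt l * sqrt m * r \<le> c"
  shows "E \<le> c"
  using assms n \<epsilon> by (simp add: E_def real_sqrt_divide real_sqrt_mult r_def power_divide)

lemma P_le:
  assumes "\<epsilon> * r * Y \<le> c" "\<epsilon>\<^sup>2 * Y \<le> c" "\<epsilon> * sqrt m * r * sqrt Y \<le> c" "sqrt m * r\<^sup>2 * y \<le> c"
  shows "P \<le> c"
  using assms n \<epsilon> by (simp add: P_def real_sqrt_divide real_sqrt_mult r_def power_divide mult_ac)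

lemma E_nonneg: "0 \<le> E"
  using E_ge(1) m_nonneg r(1) by (smt (verit) mult_nonneg_nonneg real_sqrt_ge_zero zero_le_power2)

lemma L_pos: "0 < L"
  using L_ge(1) a r(1) by (smt (verit) mult_pos_pos real_sqrt_gt_zero zero_less_power)

text \<open>For positive \<open>\<epsilon>\<close> this is \<open>l \<ge> 1/2\<close>; for
  \<open>\<epsilon> = 0\<close> both sides vanish whatever \<open>l\<close> is.\<close>

lemma \<epsilon>_square_le: "\<epsilon>\<^sup>2 \<le> 2 * (\<epsilon>\<^sup>2 * l)"
  using l_pos \<epsilon>(1) by (cases "\<epsilon> = 0") auto

lemma \<epsilon>_le: "\<epsilon> \<le> 2 * (\<epsilon> * sqrt l)"
proof (cases "\<epsilon> = 0")
  case False
  then have "1/2 \<le> sqrt l"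
    using l_pos \<epsilon>(1) by (intro real_le_rsqrt) (auto simp: power2_eq_square)
  then show ?thesis using False \<epsilon>(1) by auto
qed simp

lemma sqrt_Suc_le: "0 \<le> t \<Longrightarrow> sqrt (t + 1) \<le> sqrt t + 1"
  using sqrt_add_le_add_sqrt[of t 1] by simp

text \<open>As \<open>b\<close> may be 0, \<open>sqrt (b + 1)\<close> is not bounded by a multiple
  of \<open>sqrt b\<close>. The surplus \<open>\<epsilon> * r\<close> is instead absorbed by
  \<open>\<epsilon>\<^sup>2\<close>, thanks to \<open>r \<le> \<epsilon>\<close>.\<close>

lemma b_less_aD:
  assumes "b < a"
  shows "sqrt a * r\<^sup>2 \<le> \<epsilon> * sqrt b * r + \<epsilon>\<^sup>2" "r \<le> \<epsilon>" "m = b"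
proof -
  have "sqrt a * r\<^sup>2 \<le> sqrt (b + 1) * \<epsilon> * r"
    using ba[OF assms] n by (simp add: r_def power_divide)
  then have *: "sqrt a * r \<le> sqrt (b + 1) * \<epsilon>"
    using r(1) by (simp add: power2_eq_square flip: mult.assoc)
  \<comment> \<open>Integrality of the dimensions enters here, as \<open>b + 1 \<le> a\<close>;
    cancelling \<open>sqrt a\<close> leaves \<open>r \<le> \<epsilon>\<close>.\<close>
  also have "\<dots> \<le> sqrt a * \<epsilon>"
    using ba[OF assms] \<epsilon> by (intro mult_right_mono) auto
  finally show "r \<le> \<epsilon>" using a by simp
  have "sqrt a * r * r \<le> sqrt (b + 1) * \<epsilon> * r"
    using * r by (intro mult_right_mono) auto
  also have "\<dots> \<le> (sqrt b + 1) * \<epsilon> * r"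
    using sqrt_Suc_le[OF b] r \<epsilon> by (intro mult_right_mono) auto
  also have "\<dots> \<le> \<epsilon> * sqrt b * r + \<epsilon>\<^sup>2"
    using \<open>r \<le> \<epsilon>\<close> \<epsilon> by (simp add: algebra_simps power2_eq_square mult_left_mono)
  finally show "sqrt a * r\<^sup>2 \<le> \<epsilon> * sqrt b * r + \<epsilon>\<^sup>2"
    by (simp add: power2_eq_square algebra_simps)
  show "m = b" using assms by (simp add: m_def)
qed

text \<open>Since \<open>a \<ge> 1\<close>, the shift by one costs only a factor:
  \<open>sqrt (a + 1) \<le> 2 * sqrt a\<close>.\<close>

lemma a_less_bD:
  assumes "a < b"
  shows "\<epsilon> * sqrt b * r \<le> 2 * (sqrt a * r\<^sup>2)" "m = a"
proof -
  have "sqrt b * \<epsilon> * r \<le> sqrt (a + 1) * r\<^sup>2"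
    using ab[OF assms] n by (simp add: r_def power_divide)
  also have "\<dots> \<le> (2 * sqrt a) * r\<^sup>2"
  proof (rule mult_right_mono)
    show "sqrt (a + 1) \<le> 2 * sqrt a"
      using sqrt_Suc_le[of a] a real_sqrt_ge_1_iff[of a] by linarith
  qed simp
  finally show "\<epsilon> * sqrt b * r \<le> 2 * (sqrt a * r\<^sup>2)" by (simp add: mult_ac)
  show "m = a" using assms by (simp add: m_def)
qed

lemma \<epsilon>_sqrt_m_le: "\<epsilon> * sqrt m * r \<le> 2 * (\<epsilon> * sqrt l * sqrt m * r)"
  using mult_right_mono[OF \<epsilon>_le, of "sqrt m * r"] m_nonneg r(1) by (simp add: mult_ac)

text \<open>The term with the larger dimension is traded for terms in \<open>m\<close>. The constant
  4 comes from the case \<open>b < a\<close>, where two summands each lose a factor 2 when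
  \<open>l\<close> is inserted.\<close>

lemma L_le_E: "L \<le> 4 * E"
proof (rule L_le)
  show "\<epsilon>\<^sup>2 \<le> 4 * E"
    using \<epsilon>_square_le E_ge(2) E_nonneg by linarith
  show "sqrt a * r\<^sup>2 \<le> 4 * E"
  proof (cases "b < a")
    case True
    have "sqrt a * r\<^sup>2 \<le> \<epsilon> * sqrt m * r + \<epsilon>\<^sup>2"
      using b_less_aD(1)[OF True] unfolding b_less_aD(3)[OF True] .
    then show ?thesis
      using \<epsilon>_sqrt_m_le \<epsilon>_square_le E_ge(2,3) by linarith
  next
    case False
    then show ?thesis using E_ge(1) E_nonneg by (simp add: m_def)
  qed
  show "\<epsilon> * sqrt b * r \<le> 4 * E"
  proof (cases "a < b")
    case True
    then show ?thesis using a_less_bD E_ge(1) E_nonneg by auto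
  next
    case False
    then have "m = b" by (simp add: m_def)
    then show ?thesis using \<epsilon>_sqrt_m_le E_ge(3) E_nonneg by simp
  qed
qed

text \<open>\<open>L \<le> 2 * (l * L)\<close> pays for terms without \<open>l\<close>, and
  \<open>sqrt l \<le> 2 * l\<close> handles the mixed term. At \<open>\<epsilon> = 0\<close> the
  real \<open>l\<close> cannot represent the infinite factor, so the theorem treats that case
  apart.\<close>

lemma E_le_L:
  assumes "0 < \<epsilon>"
  shows "E \<le> 4 * (l * L)"
proof (rule E_le)
  note l = l_pos[OF assms]
  have Ll: "L \<le> 2 * (l * L)" using l L_pos by simp
  have mab: "sqrt m \<le> sqrt a" "sqrt m \<le> sqrt b" by (auto simp: m_def)
  have "sqrt m * r\<^sup>2 \<le> sqrt a * r\<^sup>2"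
    using mab by (intro mult_right_mono) auto
  then show "sqrt m * r\<^sup>2 \<le> 4 * (l * L)" using L_ge(1) Ll L_pos by linarith
  show "\<epsilon>\<^sup>2 * l \<le> 4 * (l * L)"
    using mult_left_mono[OF L_ge(3), of l] l L_pos by (simp add: mult_ac)
  have "sqrt l * (\<epsilon> * sqrt m * r) \<le> (2 * l) * (\<epsilon> * sqrt b * r)"
    using mab sqrt_le_two_mult[OF l] r \<epsilon> l b m_nonneg by (intro mult_mono mult_right_mono) auto
  also have "\<dots> \<le> (2 * l) * L"
    using L_ge(2) l by (intro mult_left_mono) auto
  also have "\<dots> \<le> 4 * (l * L)"
    using Ll L_pos by simp
  finally show "\<epsilon> * sqrt l * sqrt m * r \<le> 4 * (l * L)"
    by (simp add: mult_ac)
qed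

text \<open>The two forms of \<open>square_mult_ln_inverse_le\<close> replace \<open>l\<close> by
  \<open>Y\<close>: the one with remainder \<open>\<epsilon> * r\<close> in the pure term, the one
  with remainder \<open>r\<^sup>2\<close> in the mixed term.\<close>

lemma E_le_P: "E \<le> 4 * P"
proof (rule E_le)
  have lY: "\<epsilon>\<^sup>2 * ln n / 2 \<le> \<epsilon>\<^sup>2 * Y / 2"
    using Y(3) by (intro divide_right_mono mult_left_mono) auto
  have er: "\<epsilon> * r \<le> 2 * (\<epsilon> * r * Y)"
    using mult_left_mono[OF Y(1), of "\<epsilon> * r"] \<epsilon> r by simp
  have mr: "sqrt m * r\<^sup>2 \<le> 2 * (sqrt m * r\<^sup>2 * y)"
    using mult_left_mono[OF y, of "sqrt m * r\<^sup>2"] m_nonneg by simp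
  have "0 \<le> \<epsilon>\<^sup>2 * Y" using Y(1) by simp
  then have P0: "0 \<le> P" using P_ge(2) by linarith
  show "sqrt m * r\<^sup>2 \<le> 4 * P" using mr P_ge(4) P0 by linarith
  show "\<epsilon>\<^sup>2 * l \<le> 4 * P"
  proof -
    have "\<epsilon>\<^sup>2 * l \<le> \<epsilon>\<^sup>2 * ln n / 2 + \<epsilon> * r"
      using square_mult_ln_inverse_le(1)[OF \<epsilon>(1) n] by (simp add: l_def r_def)
    then show ?thesis using lY er P_ge(1,2) P0 by linarith
  qed
  \<comment> \<open>After taking roots, the remainder \<open>r\<close> times
    \<open>sqrt m * r\<close> is \<open>sqrt m * r\<^sup>2\<close>, which the last term of
    \<open>P\<close> covers.\<close>
  have "\<epsilon>\<^sup>2 * l \<le> \<epsilon>\<^sup>2 * Y + r\<^sup>2"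
  proof -
    have "\<epsilon>\<^sup>2 * l \<le> \<epsilon>\<^sup>2 * ln n / 2 + r\<^sup>2"
      using square_mult_ln_inverse_le(2)[OF \<epsilon>(1) n] by (simp add: l_def r(2))
    moreover have "0 \<le> \<epsilon>\<^sup>2 * Y" using Y(1) by simp
    ultimately show ?thesis using lY by linarith
  qed
  then have "sqrt (\<epsilon>\<^sup>2 * l) \<le> sqrt (\<epsilon>\<^sup>2 * Y + r\<^sup>2)" by simp
  also have "\<dots> \<le> sqrt (\<epsilon>\<^sup>2 * Y) + sqrt (r\<^sup>2)"
    using Y(1) by (intro sqrt_add_le_add_sqrt) auto
  finally have "\<epsilon> * sqrt l \<le> \<epsilon> * sqrt Y + r"
    using \<epsilon> r by (simp add: real_sqrt_mult)
  then have "\<epsilon> * sqrt l * (sqrt m * r) \<le> (\<epsilon> * sqrt Y + r) * (sqrt m * r)"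
    using m_nonneg r by (intro mult_right_mono) auto
  also have "\<dots> = \<epsilon> * sqrt m * r * sqrt Y + sqrt m * r\<^sup>2"
    by (simp add: algebra_simps power2_eq_square)
  finally show "\<epsilon> * sqrt l * sqrt m * r \<le> 4 * P"
    using P_ge(3,4) mr P0 by (simp only: mult.assoc)
qed

text \<open>Each term of \<open>P\<close> is at most a multiple of \<open>Y\<close> times a quantity
  controlled by \<open>E\<close>. Only \<open>\<epsilon> * r\<close> has no direct counterpart in
  \<open>E\<close>; it is bounded by cases on \<open>r \<le> \<epsilon>\<close>.\<close>

lemma P_le_E: "P \<le> 4 * (Y * E)"
proof (rule P_le)
  have Y0: "0 \<le> Y" using Y(1) by simp
  have scale: "u * Y \<le> c * (Y * E)" if "u \<le> c * E" for u c
    using mult_right_mono[OF that Y0] by (simp add: mult_ac)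
  have YE: "0 \<le> Y * E" using Y0 E_nonneg by simp
  have e2: "\<epsilon>\<^sup>2 \<le> 4 * E" using \<epsilon>_square_le E_ge(2) E_nonneg by linarith
  show "\<epsilon>\<^sup>2 * Y \<le> 4 * (Y * E)" by (rule scale[OF e2])
  have "\<epsilon> * r \<le> 4 * E"
  proof (cases "r \<le> \<epsilon>")
    case True
    then have "\<epsilon> * r \<le> \<epsilon>\<^sup>2" using \<epsilon> by (simp add: power2_eq_square mult_left_mono)
    then show ?thesis using e2 by simp
  next
    case False
    \<comment> \<open>\<open>r > \<epsilon>\<close> rules out \<open>b < a\<close>, so
      \<open>m = a \<ge> 1\<close> and \<open>r\<^sup>2\<close> is dominated by the first term of
      \<open>E\<close>.\<close>
    then have "m = a" using b_less_aD(2) by (force simp: m_def)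
    then have "1 * r\<^sup>2 \<le> sqrt m * r\<^sup>2" using a by (intro mult_right_mono) auto
    moreover have "\<epsilon> * r \<le> r\<^sup>2" using False r by (simp add: power2_eq_square)
    ultimately show ?thesis using E_ge(1) E_nonneg by linarith
  qed
  then show "\<epsilon> * r * Y \<le> 4 * (Y * E)" by (rule scale)
  have "\<epsilon> * sqrt m * r * sqrt Y \<le> \<epsilon> * sqrt m * r * (2 * Y)"
    using sqrt_le_two_mult[OF Y(1)] \<epsilon> m_nonneg r by (intro mult_left_mono) auto
  moreover have "\<epsilon> * sqrt m * r * Y \<le> 2 * (Y * E)"
    using \<epsilon>_sqrt_m_le E_ge(3) by (intro scale) linarith
  ultimately show "\<epsilon> * sqrt m * r * sqrt Y \<le> 4 * (Y * E)" by simp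
  have "sqrt m * r\<^sup>2 * y \<le> sqrt m * r\<^sup>2 * Y"
    using Y(2) m_nonneg by (intro mult_left_mono) auto
  moreover have "sqrt m * r\<^sup>2 * Y \<le> 1 * (Y * E)"
    using E_ge(1) by (intro scale) simp
  ultimately show "sqrt m * r\<^sup>2 * y \<le> 4 * (Y * E)" using YE by simp
qed

end

section \<open>Universal constants and the extended-real form of the bounds\<close>

theorem corollary3p15:
  shows "\<exists>C::real. C > 0 \<and>
    (\<exists>(n::nat) (q :: nat \<Rightarrow> nat \<Rightarrow> nat \<Rightarrow> real).
      (\<forall>i j k. q i j k \<ge> 0) \<and>
      (\<forall>(c0::real) (d::nat) (K :: real vec set) (\<sigma>::real) (N::nat) (\<epsilon>::real) (\<alpha>::real).
         0 < c0 \<longrightarrow> c0 < 1/2 \<longrightarrow>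
         qco_set d K \<longrightarrow> \<sigma> > 0 \<longrightarrow> N \<ge> 1 \<longrightarrow>
         0 \<le> \<epsilon> \<longrightarrow> \<epsilon> < c0 \<longrightarrow> 0 < \<alpha> \<longrightarrow> \<alpha> < 1/2 \<longrightarrow>
         kolmogorov_width d K 0 > ereal (\<sigma> / sqrt N) \<longrightarrow>
           L_sq d K \<sigma> N \<epsilon> \<le> C * E_sq d K \<sigma> N \<epsilon> \<and>
           ereal (E_sq d K \<sigma> N \<epsilon>) \<le> ereal C * ln_inv \<epsilon> * ereal (L_sq d K \<sigma> N \<epsilon>) \<and>
           E_sq d K \<sigma> N \<epsilon> \<le> C * P_sq d K \<sigma> N \<epsilon> \<alpha> \<and>
           ereal (P_sq d K \<sigma> N \<epsilon> \<alpha>)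
             \<le> ereal C
               * eval_poly3 n q (ereal (ln N)) (ereal (ln (1 / \<alpha>))) (ln_inv \<epsilon>)
               * ereal (E_sq d K \<sigma> N \<epsilon>)))"
proof -
  define q :: "nat \<Rightarrow> nat \<Rightarrow> nat \<Rightarrow> real" where
    "q = (\<lambda>i j k. if i + j = 1 \<and> k = 0 then 1 else 0)"
  \<comment> \<open>\<open>c0\<close> enters only through \<open>\<epsilon> < 1/2\<close>, so the
    constants are uniform in it.\<close>
  have bounds: "L_sq d K \<sigma> N \<epsilon> \<le> 4 * E_sq d K \<sigma> N \<epsilon> \<and>
      ereal (E_sq d K \<sigma> N \<epsilon>) \<le> ereal 4 * ln_inv \<epsilon> * ereal (L_sq d K \<sigma> N \<epsilon>) \<and>
      E_sq d K \<sigma> N \<epsilon> \<le> 4 * P_sq d K \<sigma> N \<epsilon> \<alpha> \<and>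
      ereal (P_sq d K \<sigma> N \<epsilon> \<alpha>)
        \<le> ereal 4 * eval_poly3 1 q (ereal (ln N)) (ereal (ln (1 / \<alpha>))) (ln_inv \<epsilon>)
          * ereal (E_sq d K \<sigma> N \<epsilon>)"
    if "qco_set d K" and \<sigma>: "\<sigma> > 0" and N: "N \<ge> 1" and \<epsilon>: "0 \<le> \<epsilon>" "\<epsilon> < 1/2"
      and \<alpha>: "0 < \<alpha>" "\<alpha> < 1/2" and D: "kolmogorov_width d K 0 > ereal (\<sigma> / sqrt N)"
    for d N :: nat and K and \<sigma> \<epsilon> \<alpha> :: real
  proof -
    have K: "K \<subseteq> carrier_vec d" using that(1) by (simp add: qco_set_def)
    interpret rate_comparison "opt_dim1 d K \<sigma> N" "opt_dim2 d K \<sigma> N \<epsilon>" N \<epsilon> "ln (1 / \<alpha>)"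
    proof
      show "1 \<le> real (opt_dim1 d K \<sigma> N)" using opt_dim1_pos[OF K \<sigma> D] by simp
      show "1/2 \<le> ln (1 / \<alpha>)" using \<alpha> by (rule half_le_ln_inverse)
    qed (use N \<epsilon> opt_dim2_less_opt_dim1D[OF K \<sigma> \<epsilon>(1)] opt_dim1_less_opt_dim2D[OF K \<sigma> \<epsilon>(1)]
      in \<open>auto simp: add.commute\<close>)
    have m_eq: "real (opt_dim_min d K \<sigma> N \<epsilon>) = m"
      by (simp add: m_def opt_dim_min_def)
    have Y_eq: "ln (real N / \<alpha>) = Y"
      unfolding Y_def using N \<alpha> by (simp add: ln_div)
    have L_eq: "L_sq d K \<sigma> N \<epsilon> = \<sigma>\<^sup>2 * L"
      unfolding L_sq_def L_def ..
    have E_eq: "E_sq d K \<sigma> N \<epsilon> = \<sigma>\<^sup>2 * E"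
      unfolding E_sq_def E_def Let_def m_eq l_def ..
    have P_eq: "P_sq d K \<sigma> N \<epsilon> \<alpha> = \<sigma>\<^sup>2 * P"
      unfolding P_sq_def P_def Let_def m_eq Y_eq ..
    have "L_sq d K \<sigma> N \<epsilon> \<le> 4 * E_sq d K \<sigma> N \<epsilon>"
      using mult_left_mono[OF L_le_E, of "\<sigma>\<^sup>2"] by (simp add: L_eq E_eq)
    moreover have "ereal (E_sq d K \<sigma> N \<epsilon>) \<le> ereal 4 * ln_inv \<epsilon> * ereal (L_sq d K \<sigma> N \<epsilon>)"
    proof (cases "\<epsilon> = 0")
      case True
      \<comment> \<open>Positivity makes the right-hand side infinite; with a zero factor the
        product would be 0.\<close>
      have "0 < L_sq d K \<sigma> N \<epsilon>" using L_pos \<sigma> by (simp add: L_eq)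
      then show ?thesis using True by (simp add: ln_inv_def)
    next
      case False
      then have "E \<le> 4 * (l * L)" using E_le_L \<epsilon> by simp
      moreover have "ln_inv \<epsilon> = ereal l"
        unfolding ln_inv_def l_def using False by simp
      ultimately show ?thesis
        using mult_left_mono[of E "4 * (l * L)" "\<sigma>\<^sup>2"] by (simp add: L_eq E_eq mult_ac)
    qed
    moreover have "E_sq d K \<sigma> N \<epsilon> \<le> 4 * P_sq d K \<sigma> N \<epsilon> \<alpha>"
      using mult_left_mono[OF E_le_P, of "\<sigma>\<^sup>2"] by (simp add: E_eq P_eq)
    moreover have "ereal (P_sq d K \<sigma> N \<epsilon> \<alpha>)
        \<le> ereal 4 * eval_poly3 1 q (ereal (ln N)) (ereal (ln (1 / \<alpha>))) (ln_inv \<epsilon>)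
          * ereal (E_sq d K \<sigma> N \<epsilon>)"
      unfolding q_def eval_poly3_sum_of_first_two Y_def[symmetric]
      using mult_left_mono[OF P_le_E, of "\<sigma>\<^sup>2"] by (simp add: E_eq P_eq mult_ac)
    ultimately show ?thesis by blast
  qed
  have "\<forall>i j k. q i j k \<ge> 0" by (simp add: q_def)
  then show ?thesis
    using bounds by (intro exI[of _ "4 :: real"] exI[of _ "1 :: nat"] exI[of _ q] conjI allI impI) simp_all
qed

end
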